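(* Let $A\in\mathbb{R}^{n\times n}$ and $C\in\mathbb{R}^{\mathtt w\times n}$, and consider the autonomous behavior $\mathfrak{B}_{aut}$ given by $$\frac{d}{dt}x=Ax,\qquad w=Cx,$$ with $\sigma(A)\cap i\mathbb{R}\neq\emptyset$. Let the supply rate be $Q_\Sigma(w)=-w^Tw$. If there exists a storage function $Q_\psi(w)$ satisfying $$\frac{d}{dt}Q_\psi(w)\leqslant Q_\Sigma(w)\qquad\text{for all } w\in\mathfrak{B}_{aut},$$ then every $\lambda\in\sigma(A)\cap i\mathbb{R}$ is $C$-unobservable.
   Context: $\mathfrak{B}_{aut}=\{w\in C^\infty(\mathbb{R},\mathbb{R}^{\mathtt w}) : \exists\,x\in C^\infty(\mathbb{R},\mathbb{R}^n),\ \dot x=Ax,\ w=Cx\}$. A storage function $Q_\psi(w)$ is a quadratic differential form in $w$: for some $\psi(\zeta,\eta)=\sum_{j,k}\psi_{jk}\zeta^j\eta^k\in\mathbb{R}^{\mathtt w\times\mathtt w}[\zeta,\eta]$, $Q_\psi(w)=\sum_{j,k}(\frac{d^jw}{dt^j})^T\psi_{jk}\frac{d^kw}{dt^k}$. The inequality is pointwise in time. $\sigma(A)$ is the set of eigenvalues of $A$. An eigenvalue $\lambda$ of $A$ is $C$-unobservable if it is an unobservable eigenvalue of the pair $(C,A)$, i.e. there is a nonzero $v\in\mathbb{C}^n$ with $Av=\lambda v$ and $Cv=0$. *)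

theory Defs
  imports "HOL-Analysis.Analysis" "HOL-Computational_Algebra.Polynomial"
begin

definition nth_deriv :: "nat \<Rightarrow> (real \<Rightarrow> 'a::real_normed_vector) \<Rightarrow> real \<Rightarrow> 'a" where
  "nth_deriv k f = ((\<lambda>g t. vector_derivative g (at t)) ^^ k) f"

definition smooth :: "(real \<Rightarrow> 'a::real_normed_vector) \<Rightarrow> bool" where
  "smooth f \<longleftrightarrow> (\<forall>k t. nth_deriv k f differentiable (at t))"

definition aut_behavior :: "real^'n^'n \<Rightarrow> real^'n^'w \<Rightarrow> (real \<Rightarrow> real^'w) set" where
  "aut_behavior A C =
     {w. smooth w \<and>
         (\<exists>x. smooth x \<and> (\<forall>t. (x has_vector_derivative A *v x t) (at t)) \<and>
              (\<forall>t. w t = C *v x t))}"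

(* A two-variable polynomial matrix is a polynomial in zeta whose coefficients are
   polynomials in eta with matrix coefficients: psi_jk = coeff (coeff psi j) k. *)
definition qdf :: "(real^'w^'w) poly poly \<Rightarrow> (real \<Rightarrow> real^'w) \<Rightarrow> real \<Rightarrow> real" where
  "qdf \<psi> w t =
     (\<Sum>j\<le>degree \<psi>. \<Sum>k\<le>degree (coeff \<psi> j).
        nth_deriv j w t \<bullet> (coeff (coeff \<psi> j) k *v nth_deriv k w t))"

definition neg_square_supply :: "(real \<Rightarrow> real^'w) \<Rightarrow> real \<Rightarrow> real" where
  "neg_square_supply w t = - (w t \<bullet> w t)"

(* For smooth w the function qdf psi w is differentiable (qdf_differentiable below),
   so deriv is its genuine derivative. *)
definition storage_function ::
  "(real^'w^'w) poly poly \<Rightarrow> ((real \<Rightarrow> real^'w) \<Rightarrow> real \<Rightarrow> real) \<Rightarrow> (real \<Rightarrow> real^'w) set \<Rightarrow> bool" where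
  "storage_function \<psi> S B \<longleftrightarrow> (\<forall>w\<in>B. \<forall>t. deriv (qdf \<psi> w) t \<le> S w t)"

lemma qdf_differentiable:
  assumes "smooth w"
  shows "qdf \<psi> w differentiable (at t)"
proof -
  have d: "nth_deriv k w differentiable (at t)" for k
    using assms by (simp add: smooth_def)
  have "(\<lambda>t. M *v nth_deriv k w t) differentiable (at t)" for M :: "real^'a^'a" and k
    using d bounded_linear.has_derivative[OF matrix_vector_mul_bounded_linear]
    unfolding differentiable_def by blast
  then have "(\<lambda>t. \<Sum>j\<le>degree \<psi>. \<Sum>k\<le>degree (coeff \<psi> j).
      nth_deriv j w t \<bullet> (coeff (coeff \<psi> j) k *v nth_deriv k w t)) differentiable (at t)"
    using d by (intro differentiable_sum differentiable_inner ballI) auto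
  then show ?thesis
    by (simp add: qdf_def[abs_def])
qed

definition complex_matrix :: "real^'n^'m \<Rightarrow> complex^'n^'m" where
  "complex_matrix M = map_matrix complex_of_real M"

definition spectrum :: "real^'n^'n \<Rightarrow> complex set" where
  "spectrum A = {\<mu>. \<exists>v. v \<noteq> 0 \<and> complex_matrix A *v v = \<mu> *s v}"

definition imaginary_axis :: "complex set" where
  "imaginary_axis = range (\<lambda>\<omega>::real. \<i> * complex_of_real \<omega>)"

definition unobservable_eigenvalue :: "real^'n^'w \<Rightarrow> real^'n^'n \<Rightarrow> complex \<Rightarrow> bool" where
  "unobservable_eigenvalue C A \<mu> \<longleftrightarrow>
     (\<exists>v. v \<noteq> 0 \<and> complex_matrix A *v v = \<mu> *s v \<and> complex_matrix C *v v = 0)"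

end

(* An eigenvalue i*omega with eigenvector a + i b produces the trajectory
   x = cos (omega t) a - sin (omega t) b, which is periodic. The storage function along
   w = C x is then both periodic and nonincreasing, so its derivative cannot be negative
   anywhere; hence w = 0 and, at t = 0, C a = 0. The eigenvector multiplied by -i has real
   part b, so C b = 0 as well. *)

theory Submission
  imports Defs
begin

lemma nth_deriv_0 [simp]: "nth_deriv 0 f = f"
  by (simp add: nth_deriv_def)

lemma nth_deriv_Suc: "nth_deriv (Suc k) f = (\<lambda>t. vector_derivative (nth_deriv k f) (at t))"
  by (simp add: nth_deriv_def)

text \<open>Translation preserves the whole set of vector derivatives at corresponding points, by
  the chain rule in both directions. The choice operator behind \<open>vector_derivative\<close>
  therefore picks the same value on both sides, even where \<open>f\<close> is not
  differentiable.\<close>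

lemma vector_derivative_shift:
  fixes f :: "real \<Rightarrow> 'a::real_normed_vector"
  shows "vector_derivative (\<lambda>t. f (t + T)) (at t) = vector_derivative f (at (t + T))"
proof -
  have "((\<lambda>t. f (t + T)) has_vector_derivative D) (at t) \<longleftrightarrow>
        (f has_vector_derivative D) (at (t + T))" for D
  proof
    assume "((\<lambda>t. f (t + T)) has_vector_derivative D) (at t)"
    then have "(((\<lambda>t. f (t + T)) \<circ> (\<lambda>s. s - T)) has_vector_derivative 1 *\<^sub>R D) (at (t + T))"
      by (intro vector_diff_chain_at) (auto intro!: derivative_eq_intros)
    then show "(f has_vector_derivative D) (at (t + T))"
      by (simp add: o_def)
  next
    assume "(f has_vector_derivative D) (at (t + T))"
    then have "((f \<circ> (\<lambda>s. s + T)) has_vector_derivative 1 *\<^sub>R D) (at t)"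
      by (intro vector_diff_chain_at) (auto intro!: derivative_eq_intros)
    then show "((\<lambda>t. f (t + T)) has_vector_derivative D) (at t)"
      by (simp add: o_def)
  qed
  then show ?thesis
    by (simp add: vector_derivative_def)
qed

lemma nth_deriv_periodic:
  assumes "\<And>t. f (t + T) = f t"
  shows "nth_deriv k f (t + T) = nth_deriv k f t"
proof (induction k arbitrary: t)
  case (Suc k)
  have "(\<lambda>t. nth_deriv k f (t + T)) = nth_deriv k f"
    using Suc.IH by blast
  then show ?case
    using vector_derivative_shift[of "nth_deriv k f" T t] by (simp add: nth_deriv_Suc)
qed (simp add: assms)

lemma qdf_periodic:
  assumes "\<And>t. w (t + T) = w t"
  shows "qdf \<psi> w (t + T) = qdf \<psi> w t"
  by (simp add: qdf_def nth_deriv_periodic[where f = w and T = T, OF assms])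

text \<open>The real part of e^(i \<omega> t) (p + i q), written without complexifying the space of
  values.\<close>

definition harmonic :: "real \<Rightarrow> 'a::real_normed_vector \<Rightarrow> 'a \<Rightarrow> real \<Rightarrow> 'a" where
  "harmonic \<omega> p q = (\<lambda>t. cos (\<omega> * t) *\<^sub>R p - sin (\<omega> * t) *\<^sub>R q)"

text \<open>Differentiation multiplies the complex amplitude p + i q by i \<omega>, which gives
  -\<omega> q + i \<omega> p.\<close>

lemma has_vector_derivative_harmonic:
  "(harmonic \<omega> p q has_vector_derivative harmonic \<omega> (- \<omega> *\<^sub>R q) (\<omega> *\<^sub>R p) t) (at t)"
proof -
  have "((\<lambda>t. cos (\<omega> * t)) has_field_derivative - \<omega> * sin (\<omega> * t)) (at t)"
    and "((\<lambda>t. sin (\<omega> * t)) has_field_derivative \<omega> * cos (\<omega> * t)) (at t)"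
    by (auto intro!: derivative_eq_intros)
  then have "(harmonic \<omega> p q has_vector_derivative
      (- \<omega> * sin (\<omega> * t)) *\<^sub>R p - (\<omega> * cos (\<omega> * t)) *\<^sub>R q) (at t)"
    unfolding harmonic_def
    by (intro has_vector_derivative_diff)
      (auto dest: has_vector_derivative_scaleR[OF _ has_vector_derivative_const])
  also have "(- \<omega> * sin (\<omega> * t)) *\<^sub>R p - (\<omega> * cos (\<omega> * t)) *\<^sub>R q =
      harmonic \<omega> (- \<omega> *\<^sub>R q) (\<omega> *\<^sub>R p) t"
    by (simp add: harmonic_def mult.commute)
  finally show ?thesis .
qed

text \<open>The family is closed under differentiation; for smoothness the exact amplitude is
  irrelevant, so it stays existential.\<close>

lemma nth_deriv_harmonic: "\<exists>p' q'. nth_deriv k (harmonic \<omega> p q) = harmonic \<omega> p' q'"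
proof (induction k)
  case (Suc k)
  then obtain p' q' where "nth_deriv k (harmonic \<omega> p q) = harmonic \<omega> p' q'"
    by blast
  then have "nth_deriv (Suc k) (harmonic \<omega> p q) = harmonic \<omega> (- \<omega> *\<^sub>R q') (\<omega> *\<^sub>R p')"
    by (simp add: nth_deriv_Suc vector_derivative_at[OF has_vector_derivative_harmonic])
  then show ?case
    by blast
qed auto

lemma smooth_harmonic: "smooth (harmonic \<omega> p q)"
  unfolding smooth_def
proof (intro allI)
  fix k t
  obtain p' q' where "nth_deriv k (harmonic \<omega> p q) = harmonic \<omega> p' q'"
    using nth_deriv_harmonic by blast
  then show "nth_deriv k (harmonic \<omega> p q) differentiable at t"
    using differentiableI_vector[OF has_vector_derivative_harmonic] by simp
qed

lemma harmonic_period: "\<exists>T>0. \<forall>t. harmonic \<omega> p q (t + T) = harmonic \<omega> p q t"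
proof (cases "\<omega> = 0")
  case True
  then show ?thesis
    by (intro exI[of _ 1]) (simp add: harmonic_def)
next
  case False
  \<comment> \<open>The absolute value keeps the period positive; for negative \<omega> the phase
    then moves by -2 pi, hence the \<open>sgn\<close>.\<close>
  have eq: "\<omega> * (t + 2 * pi / \<bar>\<omega>\<bar>) = \<omega> * t + sgn \<omega> * (2 * pi)" for t
    using False by (auto simp: abs_if sgn_if field_simps)
  have "harmonic \<omega> p q (t + 2 * pi / \<bar>\<omega>\<bar>) = harmonic \<omega> p q t" for t
    unfolding harmonic_def eq using False by (auto simp: sgn_if cos_add sin_add)
  then show ?thesis
    using False by (intro exI[of _ "2 * pi / \<bar>\<omega>\<bar>"]) simp
qed

lemma storage_periodic_imp_zero:
  assumes st: "storage_function \<psi> neg_square_supply B" and "w \<in> B" and "smooth w"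
    and "T > 0" and per: "\<And>t. w (t + T) = w t"
  shows "w t = 0"
proof (rule ccontr)
  assume nz: "w t \<noteq> 0"
  let ?Q = "qdf \<psi> w"
  have D: "DERIV ?Q s :> deriv ?Q s" for s
    using qdf_differentiable[OF \<open>smooth w\<close>] DERIV_deriv_iff_real_differentiable by blast
  have le: "deriv ?Q s \<le> - (w s \<bullet> w s)" for s
    using st \<open>w \<in> B\<close> by (auto simp: storage_function_def neg_square_supply_def)
  have "deriv ?Q s \<le> 0" for s
    using le[of s] inner_ge_zero[of "w s"] by linarith
  then have anti: "?Q b \<le> ?Q a" if "a \<le> b" for a b
    using DERIV_nonpos_imp_nonincreasing[OF that, of ?Q] D by blast
  have "w t \<bullet> w t > 0"
    using nz by simp
  then have "deriv ?Q t < 0"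
    using le[of t] by linarith
  then obtain d where "d > 0" and dec: "\<And>h. 0 < h \<Longrightarrow> h < d \<Longrightarrow> ?Q (t + h) < ?Q t"
    using DERIV_neg_dec_right[OF D] by blast
  \<comment> \<open>The step length must lie strictly between 0 and \<open>d\<close> for the strict
    decrease, and be at most \<open>T\<close> so that monotonicity can compare with the value one
    period later.\<close>
  have "?Q (t + min (d / 2) T) < ?Q t"
    using \<open>d > 0\<close> \<open>T > 0\<close> by (intro dec) auto
  also have "?Q t = ?Q (t + T)"
    by (simp add: qdf_periodic[where w = w and T = T, OF per])
  also have "\<dots> \<le> ?Q (t + min (d / 2) T)"
    by (intro anti) simp
  finally show False
    by simp
qed

text \<open>The hypotheses are the real and imaginary parts of A (a + i b) = i \<omega> (a + i b):
  applying \<open>A\<close> to the amplitude has the same effect as differentiating.\<close>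

lemma harmonic_in_aut_behavior:
  fixes A :: "real^'n^'n" and C :: "real^'n^'w"
  assumes "A *v a = - \<omega> *\<^sub>R b" and "A *v b = \<omega> *\<^sub>R a"
  shows "harmonic \<omega> (C *v a) (C *v b) \<in> aut_behavior A C"
proof -
  \<comment> \<open>Used with \<open>A\<close> to verify the state equation and with
    \<open>C\<close> to recognize the output as harmonic again.\<close>
  have lin: "M *v harmonic \<omega> p q t = harmonic \<omega> (M *v p) (M *v q) t"
    for M :: "real^'n^'k" and p q t
    by (simp add: harmonic_def matrix_vector_mult_diff_distrib matrix_vector_mult_scaleR)
  have "(harmonic \<omega> a b has_vector_derivative A *v harmonic \<omega> a b t) (at t)" for t
    unfolding lin assms by (rule has_vector_derivative_harmonic)
  then show ?thesis
    unfolding aut_behavior_def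
    by (auto simp: lin smooth_harmonic intro!: exI[of _ "harmonic \<omega> a b"])
qed

text \<open>The entries of \<open>M\<close> are real, so no cross terms arise.\<close>

lemma complex_matrix_mult_nth:
  "(complex_matrix M *v v) $ i =
     Complex ((M *v (\<chi> j. Re (v $ j))) $ i) ((M *v (\<chi> j. Im (v $ j))) $ i)"
  by (simp add: complex_eq_iff complex_matrix_def map_matrix_def matrix_vector_mult_def)

text \<open>Stated for any solution \<open>v\<close> of the eigenvector equation, so that it applies
  to every complex multiple of a given eigenvector.\<close>

lemma storage_imp_output_Re_zero:
  fixes A :: "real^'n^'n" and C :: "real^'n^'w"
  assumes st: "storage_function \<psi> neg_square_supply (aut_behavior A C)"
    and ev: "complex_matrix A *v v = (\<i> * complex_of_real \<omega>) *s v"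
  shows "C *v (\<chi> j. Re (v $ j)) = 0"
proof -
  define a b where "a = (\<chi> j. Re (v $ j))" and "b = (\<chi> j. Im (v $ j))"
  have "Complex ((A *v a) $ i) ((A *v b) $ i) = \<i> * complex_of_real \<omega> * v $ i" for i
    using arg_cong[OF ev, of "\<lambda>u. u $ i"] by (simp add: complex_matrix_mult_nth a_def b_def)
  \<comment> \<open>Compare real and imaginary parts of i \<omega> (a + i b) = -\<omega> b + i
    \<omega> a.\<close>
  then have ab: "A *v a = - \<omega> *\<^sub>R b" "A *v b = \<omega> *\<^sub>R a"
    by (simp_all add: vec_eq_iff complex_eq_iff a_def b_def)
  let ?w = "harmonic \<omega> (C *v a) (C *v b)"
  obtain T where "T > 0" "\<And>t. ?w (t + T) = ?w t"
    using harmonic_period by blast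
  then have "?w 0 = 0"
    using storage_periodic_imp_zero[OF st harmonic_in_aut_behavior[OF ab] smooth_harmonic] by blast
  then show ?thesis
    by (simp add: harmonic_def a_def)
qed

theorem lemma7p1:
  fixes A :: "real^'n^'n" and C :: "real^'n^'w"
  assumes "spectrum A \<inter> imaginary_axis \<noteq> {}"
    and "\<exists>\<psi>. storage_function \<psi> neg_square_supply (aut_behavior A C)"
  shows "\<forall>\<mu> \<in> spectrum A \<inter> imaginary_axis. unobservable_eigenvalue C A \<mu>"
proof
  fix \<mu> assume "\<mu> \<in> spectrum A \<inter> imaginary_axis"
  then obtain v \<omega> where "v \<noteq> 0" and ev: "complex_matrix A *v v = \<mu> *s v"
    and \<mu>: "\<mu> = \<i> * complex_of_real \<omega>"
    by (auto simp: spectrum_def imaginary_axis_def)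
  obtain \<psi> where st: "storage_function \<psi> neg_square_supply (aut_behavior A C)"
    using assms(2) by blast
  have ev': "complex_matrix A *v ((- \<i>) *s v) = \<mu> *s ((- \<i>) *s v)"
    by (simp only: vector_scalar_commute ev vector_smult_assoc mult.commute)
  have "C *v (\<chi> j. Re (v $ j)) = 0"
    using storage_imp_output_Re_zero[OF st ev[unfolded \<mu>]] .
  moreover have "C *v (\<chi> j. Im (v $ j)) = 0"
    using storage_imp_output_Re_zero[OF st ev'[unfolded \<mu>]] by simp
  \<comment> \<open>Since \<open>C\<close> is real, C v has real part C (Re v) and imaginary part C
    (Im v), both now zero.\<close>
  ultimately have "complex_matrix C *v v = 0"
    by (simp add: vec_eq_iff complex_matrix_mult_nth complex_eq_iff)
  then show "unobservable_eigenvalue C A \<mu>"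
    using \<open>v \<noteq> 0\<close> ev by (auto simp: unobservable_eigenvalue_def)
qed

end
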